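(* Let $\Omega\subset\mathbb{R}^{n}$ be a smoothly bounded, convex domain and let $p\in b\Omega$. Then there exist a neighborhood $V\subset\mathbb{R}^{n}$ of $p$ and a smooth local defining function $\rho$ for $\Omega$ on $V$ such that $\rho$ is convex on $V$, i.e. $\sum_{j,k=1}^{n}\frac{\partial^{2}\rho}{\partial x_{j}\partial x_{k}}(x)\,\xi_{j}\xi_{k}\geq 0$ for all $x\in V$ and all $\xi\in\mathbb{R}^{n}$.
   Context: Smooth means $C^{\infty}$; neighborhoods are open; $b\Omega$ denotes the topological boundary of $\Omega$. A defining function for an open set $\Omega\subset\mathbb{R}^{n}$ is a function $r:\mathbb{R}^{n}\to\mathbb{R}$ with $\Omega=\{x: r(x)<0\}$. A local defining function for $\Omega$ on an open set $U$ is a function $r:U\to\mathbb{R}$ with $\Omega\cap U=\{x\in U: r(x)<0\}$. $\Omega$ is smoothly bounded if it admits a $C^{\infty}$ defining function $r$ with $\nabla r\neq 0$ in a neighborhood of $\{x\in\mathbb{R}^n: r(x)=0\}=b\Omega$. For such $r$, the tangent space at $x\in b\Omega$ is $T_{x}(b\Omega)=\{\xi\in\mathbb{R}^{n}:\langle\nabla r(x),\xi\rangle=0\}$; it does not depend on the choice of $r$. The smoothly bounded domain $\Omega$ is convex if $\sum_{j,k=1}^{n}\frac{\partial^{2}r}{\partial x_{j}\partial x_{k}}(p)\,\tau_{j}\tau_{k}\geq 0$ for all $p\in b\Omega$ and all $\tau\in T_{p}(b\Omega)$, where $r$ is such a defining function (the condition does not depend on the choice of $r$). *)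

theory Defs
  imports "HOL-Analysis.Analysis"
begin

text \<open>Functions are total in HOL, so a function defined on an open set \<open>U\<close> is represented by a
  function on the whole space that is constrained on \<open>U\<close> only.  For open \<open>U\<close> all notions below
  depend only on the values on \<open>U\<close>.\<close>

primrec C_k_on :: "nat \<Rightarrow> (real ^ 'n \<Rightarrow> real) \<Rightarrow> (real ^ 'n) set \<Rightarrow> bool" where
  "C_k_on 0 f U \<longleftrightarrow> continuous_on U f"
| "C_k_on (Suc k) f U \<longleftrightarrow>
     (\<forall>x\<in>U. f differentiable (at x)) \<and>
     (\<forall>v. C_k_on k (\<lambda>x. frechet_derivative f (at x) v) U)"

definition smooth_on :: "(real ^ 'n \<Rightarrow> real) \<Rightarrow> (real ^ 'n) set \<Rightarrow> bool" where
  "smooth_on f U \<longleftrightarrow> open U \<and> (\<forall>k. C_k_on k f U)"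

text \<open>The partial derivative, for functions that are differentiable at the given point.\<close>

definition partial_deriv :: "'n \<Rightarrow> (real ^ 'n \<Rightarrow> real) \<Rightarrow> real ^ 'n \<Rightarrow> real" where
  "partial_deriv j f x = frechet_derivative f (at x) (axis j 1)"

definition grad :: "(real ^ 'n \<Rightarrow> real) \<Rightarrow> real ^ 'n \<Rightarrow> real ^ 'n" where
  "grad f x = (\<chi> j. partial_deriv j f x)"

definition hessian_form :: "(real ^ 'n \<Rightarrow> real) \<Rightarrow> real ^ 'n \<Rightarrow> real ^ 'n \<Rightarrow> real" where
  "hessian_form f x \<xi> =
     (\<Sum>j\<in>UNIV. \<Sum>k\<in>UNIV. partial_deriv j (partial_deriv k f) x * \<xi> $ j * \<xi> $ k)"

definition defining_function :: "(real ^ 'n \<Rightarrow> real) \<Rightarrow> (real ^ 'n) set \<Rightarrow> bool" where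
  "defining_function r \<Omega> \<longleftrightarrow> \<Omega> = {x. r x < 0}"

definition local_defining_function ::
    "(real ^ 'n \<Rightarrow> real) \<Rightarrow> (real ^ 'n) set \<Rightarrow> (real ^ 'n) set \<Rightarrow> bool" where
  "local_defining_function \<rho> \<Omega> U \<longleftrightarrow> open U \<and> \<Omega> \<inter> U = {x \<in> U. \<rho> x < 0}"

definition regular_defining_function :: "(real ^ 'n \<Rightarrow> real) \<Rightarrow> (real ^ 'n) set \<Rightarrow> bool" where
  "regular_defining_function r \<Omega> \<longleftrightarrow>
     defining_function r \<Omega> \<and> smooth_on r UNIV \<and> {x. r x = 0} = frontier \<Omega> \<and>
     (\<exists>N. open N \<and> {x. r x = 0} \<subseteq> N \<and> (\<forall>x\<in>N. grad r x \<noteq> 0))"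

text \<open>Boundedness of \<open>\<Omega>\<close> as a set is not part of the notion.\<close>

definition smoothly_bounded :: "(real ^ 'n) set \<Rightarrow> bool" where
  "smoothly_bounded \<Omega> \<longleftrightarrow> (\<exists>r. regular_defining_function r \<Omega>)"

definition tangent_space :: "(real ^ 'n \<Rightarrow> real) \<Rightarrow> real ^ 'n \<Rightarrow> (real ^ 'n) set" where
  "tangent_space r x = {\<xi>. grad r x \<bullet> \<xi> = 0}"

text \<open>Neither the tangent space nor the condition below depends on the choice of \<open>r\<close>, so
  \<open>convex_boundary\<close> asks for it for some \<open>r\<close>; a priori this is the weakest reading.\<close>

definition convex_boundary :: "(real ^ 'n) set \<Rightarrow> bool" where
  "convex_boundary \<Omega> \<longleftrightarrow>
     (\<exists>r. regular_defining_function r \<Omega> \<and>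
          (\<forall>p\<in>frontier \<Omega>. \<forall>\<tau>\<in>tangent_space r p. hessian_form r p \<tau> \<ge> 0))"

end

theory Submission
  imports Defs
begin

text \<open>Put \<open>e = \<nabla>r(p)\<close> and let \<open>\<rho>(x)\<close> be the number \<open>t\<close> with \<open>r(x - t e) = 0\<close>, which exists and is
  unique near \<open>p\<close> because \<open>r\<close> increases in direction \<open>e\<close> there.  Then \<open>\<rho> < 0\<close> exactly where
  \<open>r < 0\<close>.  With \<open>y = x - \<rho>(x) e \<in> b\<Omega>\<close>, differentiating \<open>r(x - \<rho>(x) e) = 0\<close> once shows that \<open>\<rho>\<close> is
  smooth and that \<open>P\<xi> = \<xi> - (D\<rho>(x)\<xi>) e\<close> is tangent to \<open>b\<Omega>\<close> at \<open>y\<close>; differentiating it twice gives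
  \<open>D\<^sup>2\<rho>(x)(\<xi>,\<xi>) \<cdot> Dr(y)e = D\<^sup>2r(y)(P\<xi>,P\<xi>) \<ge> 0\<close>.\<close>

section \<open>Closure properties of \<open>C\<^sup>k\<close> functions\<close>

lemma frechet_derivative_eqI:
  "(f has_derivative D) (at x) \<Longrightarrow> frechet_derivative f (at x) v = D v"
  by (drule frechet_derivative_at) simp

text \<open>A Frechet derivative at a point of the open set \<open>U\<close> sees only values inside
  \<open>U\<close>, so agreement on \<open>U\<close> passes to all directional derivatives and the
  induction closes with \<open>f\<close> and \<open>g\<close> arbitrary.\<close>

lemma C_k_on_cong:
  assumes "open U" "\<And>x. x \<in> U \<Longrightarrow> f x = g x" "C_k_on k f U"
  shows "C_k_on k g U"
  using assms(2,3)
proof (induction k arbitrary: f g)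
  case 0
  then show ?case
    using continuous_on_cong[of U U f g] by simp
next
  case (Suc k)
  have f: "f differentiable (at x)" if "x \<in> U" for x
    using Suc.prems(2) that by simp
  have "g differentiable (at x)" if "x \<in> U" for x
  proof -
    obtain D where "(f has_derivative D) (at x)"
      using f[OF \<open>x \<in> U\<close>] by (auto simp: differentiable_def)
    from has_derivative_transform_within_open[OF this \<open>open U\<close> that Suc.prems(1)]
    show ?thesis by (rule differentiableI)
  qed
  moreover have "C_k_on k (\<lambda>x. frechet_derivative g (at x) v) U" for v
  proof (rule Suc.IH[of "\<lambda>x. frechet_derivative f (at x) v"])
    show "frechet_derivative f (at x) v = frechet_derivative g (at x) v" if "x \<in> U" for x
      using frechet_derivative_transform_within_open[OF f[OF that] \<open>open U\<close> that Suc.prems(1)]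
      by (rule fun_cong)
    show "C_k_on k (\<lambda>x. frechet_derivative f (at x) v) U"
      using Suc.prems(2) by simp
  qed
  ultimately show ?case by simp
qed

lemma C_k_on_Suc_imp: "C_k_on (Suc k) f U \<Longrightarrow> C_k_on k f U"
proof (induction k arbitrary: f)
  case 0
  then show ?case
    by (auto intro!: continuous_at_imp_continuous_on differentiable_imp_continuous_within)
next
  case (Suc k)
  then show ?case by (meson C_k_on.simps(2))
qed

lemma C_k_on_const: "C_k_on k (\<lambda>x. c) U"
  by (induction k arbitrary: c) auto

text \<open>Lets the closure proofs below work with an explicit formula for the derivative; by
  \<open>C_k_on_cong\<close> the formula has to be right on \<open>U\<close> only.\<close>

lemma C_k_on_SucI:
  assumes "open U" "\<And>x. x \<in> U \<Longrightarrow> (f has_derivative D x) (at x)"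
    "\<And>v. C_k_on k (\<lambda>x. D x v) U"
  shows "C_k_on (Suc k) f U"
proof -
  have "C_k_on k (\<lambda>x. frechet_derivative f (at x) v) U" for v
    by (rule C_k_on_cong[OF assms(1) _ assms(3)[of v]])
       (simp add: frechet_derivative_eqI[OF assms(2)])
  then show ?thesis using assms(2) by (auto simp: differentiable_def)
qed

lemma C_k_on_Suc_has_derivative:
  "C_k_on (Suc k) f U \<Longrightarrow> x \<in> U \<Longrightarrow> (f has_derivative frechet_derivative f (at x)) (at x)"
  by (simp add: frechet_derivative_works)

lemma C_k_on_add:
  assumes "open U" "C_k_on k f U" "C_k_on k g U"
  shows "C_k_on k (\<lambda>x. f x + g x) U"
  using assms(2,3)
proof (induction k arbitrary: f g)
  case 0
  then show ?case by (auto intro: continuous_intros)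
next
  case (Suc k)
  show ?case
    by (rule C_k_on_SucI[OF \<open>open U\<close> has_derivative_add[OF
          C_k_on_Suc_has_derivative[OF Suc.prems(1)] C_k_on_Suc_has_derivative[OF Suc.prems(2)]]])
       (use Suc in auto)
qed

lemma C_k_on_mult:
  assumes "open U" "C_k_on k f U" "C_k_on k g U"
  shows "C_k_on k (\<lambda>x. f x * g x) U"
  using assms(2,3)
proof (induction k arbitrary: f g)
  case 0
  then show ?case by (auto intro: continuous_intros)
next
  case (Suc k)
  \<comment> \<open>Each summand of the product rule keeps one factor undifferentiated, so both
    factors are required at level \<open>k\<close> as well.\<close>
  have "C_k_on k f U" "C_k_on k g U"
    using Suc.prems C_k_on_Suc_imp by blast+
  then show ?case
    by (intro C_k_on_SucI[OF \<open>open U\<close> has_derivative_mult[OF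
          C_k_on_Suc_has_derivative[OF Suc.prems(1)] C_k_on_Suc_has_derivative[OF Suc.prems(2)]]])
       (use Suc in \<open>auto intro!: C_k_on_add[OF \<open>open U\<close>]\<close>)
qed

lemma C_k_on_uminus:
  assumes "open U" "C_k_on k f U"
  shows "C_k_on k (\<lambda>x. - f x) U"
  using C_k_on_mult[OF assms(1) C_k_on_const[of k "-1"] assms(2)] by simp

lemma C_k_on_diff:
  assumes "open U" "C_k_on k f U" "C_k_on k g U"
  shows "C_k_on k (\<lambda>x. f x - g x) U"
  using C_k_on_add[OF assms(1,2) C_k_on_uminus[OF assms(1,3)]] by simp

lemma C_k_on_inverse:
  assumes "open U" "C_k_on k f U" "\<And>x. x \<in> U \<Longrightarrow> f x \<noteq> 0"
  shows "C_k_on k (\<lambda>x. inverse (f x)) U"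
  using assms(2)
proof (induction k)
  case 0
  then show ?case using assms(3) by (auto intro: continuous_intros)
next
  case (Suc k)
  \<comment> \<open>The derivative of 1/f contains 1/f itself; the induction hypothesis supplies it
    at level \<open>k\<close>.\<close>
  have "C_k_on k (\<lambda>x. inverse (f x)) U"
    using Suc C_k_on_Suc_imp by blast
  then show ?case
    by (intro C_k_on_SucI[OF \<open>open U\<close> Deriv.has_derivative_inverse[OF assms(3)
          C_k_on_Suc_has_derivative[OF Suc.prems]]])
       (use Suc in \<open>auto intro!: C_k_on_mult[OF \<open>open U\<close>] C_k_on_uminus[OF \<open>open U\<close>]\<close>)
qed

lemma has_derivative_shift_compose:
  fixes f h :: "real ^ 'n \<Rightarrow> real"
  assumes "(f has_derivative F) (at (x - h x *\<^sub>R e))" "(h has_derivative H) (at x)"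
  shows "((\<lambda>x. f (x - h x *\<^sub>R e)) has_derivative (\<lambda>v. F v - H v * F e)) (at x)"
proof -
  have "linear F" using assms(1) has_derivative_linear by blast
  moreover have "((\<lambda>x. f (x - h x *\<^sub>R e)) has_derivative (\<lambda>v. F (v - H v *\<^sub>R e))) (at x)"
    by (rule has_derivative_compose[of "\<lambda>x. x - h x *\<^sub>R e", OF _ assms(1)])
       (use assms(2) in \<open>auto intro!: derivative_eq_intros\<close>)
  ultimately show ?thesis by (simp add: linear_diff linear_scale)
qed

text \<open>For the inner map x - h(x) e the chain rule produces only products and differences of
  real-valued functions: Dh and the directional derivatives of \<open>f\<close> at the shifted
  point. The latter are again such compositions with the same \<open>h\<close>, hence the induction
  over arbitrary \<open>f\<close>.\<close>

lemma C_k_on_shift_compose: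
  fixes f h :: "real ^ 'n \<Rightarrow> real"
  assumes "open U" "C_k_on k f UNIV" "C_k_on k h U"
  shows "C_k_on k (\<lambda>x. f (x - h x *\<^sub>R e)) U"
  using assms(2,3)
proof (induction k arbitrary: f)
  case 0
  then show ?case
    by (auto intro!: continuous_intros continuous_on_compose2[of UNIV f])
next
  case (Suc k)
  have "C_k_on k h U" using Suc.prems C_k_on_Suc_imp by blast
  then have D: "C_k_on k (\<lambda>x. frechet_derivative f (at (x - h x *\<^sub>R e)) v) U" for v
    using Suc.prems(1) by (intro Suc.IH) auto
  show ?case
    by (rule C_k_on_SucI[OF \<open>open U\<close> has_derivative_shift_compose[OF
          C_k_on_Suc_has_derivative[OF Suc.prems(1) UNIV_I]
          C_k_on_Suc_has_derivative[OF Suc.prems(2)]]])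
       (use D Suc.prems in \<open>auto intro!: C_k_on_mult[OF \<open>open U\<close>] C_k_on_diff[OF \<open>open U\<close>]\<close>)
qed

section \<open>Gradient and Hessian through Frechet derivatives\<close>

lemma linear_sum_axis:
  fixes F :: "real ^ 'n \<Rightarrow> real"
  assumes "linear F"
  shows "F v = (\<Sum>k\<in>UNIV. F (axis k 1) * v $ k)"
proof -
  have "F v = F (\<Sum>k\<in>UNIV. v $ k *\<^sub>R axis k 1)"
    by (simp add: basis_expansion scalar_mult_eq_scaleR[symmetric])
  then show ?thesis
    using assms by (simp add: linear_sum linear_scale mult.commute)
qed

lemma inner_grad:
  assumes "f differentiable (at x)"
  shows "grad f x \<bullet> v = frechet_derivative f (at x) v"
  using linear_sum_axis[OF linear_frechet_derivative[OF assms], of v]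
  by (simp add: grad_def partial_deriv_def inner_vec_def)

text \<open>Expand Df(z)\<xi> in partial derivatives near \<open>x\<close>, differentiate with \<xi>
  held fixed, and expand the outer derivative in the same way. This turns the double sum into an
  iterated directional derivative, which suits the chain rule.\<close>

lemma hessian_form_eq:
  fixes f :: "real ^ 'n \<Rightarrow> real"
  assumes "open U" "x \<in> U" "C_k_on (Suc (Suc k)) f U"
  shows "hessian_form f x \<xi> =
    frechet_derivative (\<lambda>z. frechet_derivative f (at z) \<xi>) (at x) \<xi>"
proof -
  let ?P = "\<lambda>k. frechet_derivative (partial_deriv k f) (at x)"
  have diff: "partial_deriv k f differentiable (at x)" for k
    using assms by (auto simp: partial_deriv_def[abs_def])
  have "((\<lambda>z. \<Sum>k\<in>UNIV. partial_deriv k f z * \<xi> $ k) has_derivative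
      (\<lambda>v. \<Sum>k\<in>UNIV. ?P k v * \<xi> $ k)) (at x)"
    by (auto intro!: derivative_eq_intros diff[unfolded frechet_derivative_works])
  then have "frechet_derivative (\<lambda>z. \<Sum>k\<in>UNIV. partial_deriv k f z * \<xi> $ k) (at x) \<xi> =
      (\<Sum>k\<in>UNIV. ?P k \<xi> * \<xi> $ k)"
    by (rule frechet_derivative_eqI)
  moreover have "frechet_derivative (\<lambda>z. frechet_derivative f (at z) \<xi>) (at x) =
      frechet_derivative (\<lambda>z. \<Sum>k\<in>UNIV. partial_deriv k f z * \<xi> $ k) (at x)"
  proof (rule frechet_derivative_transform_within_open[OF _ assms(1,2)])
    show "(\<lambda>z. frechet_derivative f (at z) \<xi>) differentiable (at x)"
      using assms(2,3) by auto
  next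
    fix z assume "z \<in> U"
    then have "linear (frechet_derivative f (at z))"
      using assms(3) by (auto intro: linear_frechet_derivative)
    then show "frechet_derivative f (at z) \<xi> = (\<Sum>k\<in>UNIV. partial_deriv k f z * \<xi> $ k)"
      unfolding partial_deriv_def by (rule linear_sum_axis)
  qed
  moreover have "?P k \<xi> = (\<Sum>j\<in>UNIV. ?P k (axis j 1) * \<xi> $ j)" for k
    by (rule linear_sum_axis[OF linear_frechet_derivative[OF diff]])
  ultimately show ?thesis
    unfolding hessian_form_def partial_deriv_def[of _ "partial_deriv _ _"]
    by (subst sum.swap) (simp add: sum_distrib_right)
qed

section \<open>The implicit function\<close>

text \<open>A ball is convex, so the whole segment between the two points lies where the derivative
  of \<open>r\<close> in direction \<open>e\<close> is positive. A larger shift means moving further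
  against \<open>e\<close>, which lowers \<open>r\<close>.\<close>

lemma strict_mono_on_ball_line:
  fixes r :: "'a::real_normed_vector \<Rightarrow> real"
  assumes diff: "\<And>z. z \<in> ball p \<epsilon> \<Longrightarrow> r differentiable (at z)"
    and pos: "\<And>z. z \<in> ball p \<epsilon> \<Longrightarrow> frechet_derivative r (at z) e > 0"
    and "x - a *\<^sub>R e \<in> ball p \<epsilon>" "x - b *\<^sub>R e \<in> ball p \<epsilon>" "a < b"
  shows "r (x - b *\<^sub>R e) < r (x - a *\<^sub>R e)"
proof -
  have in_ball: "x + t *\<^sub>R e \<in> ball p \<epsilon>" if "-b \<le> t" "t \<le> -a" for t
  proof -
    \<comment> \<open>The weight that writes t as the convex combination s(-a) + (1 -
      s)(-b).\<close>
    define s where "s = (t + b) / (b - a)"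
    have "s * (b - a) = t + b" using \<open>a < b\<close> by (simp add: s_def)
    then have "t = s * (-a) + (1 - s) * (-b)" by (simp add: right_diff_distrib left_diff_distrib)
    then have "t *\<^sub>R e = (s * (-a) + (1 - s) * (-b)) *\<^sub>R e" by simp
    then have eq: "x + t *\<^sub>R e = s *\<^sub>R (x - a *\<^sub>R e) + (1 - s) *\<^sub>R (x - b *\<^sub>R e)"
      by (simp only: scaleR_add_left scaleR_diff_right scaleR_scaleR) (simp add: algebra_simps)
    have "0 \<le> s" "s \<le> 1"
      using that \<open>a < b\<close> by (auto simp: s_def)
    then show ?thesis
      unfolding eq by (intro convexD[OF convex_ball assms(3,4)]) auto
  qed
  have "r (x + (-b) *\<^sub>R e) < r (x + (-a) *\<^sub>R e)"
  proof (rule DERIV_pos_imp_increasing[where f = "\<lambda>t. r (x + t *\<^sub>R e)"])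
    show "-b < -a" using \<open>a < b\<close> by simp
    fix t assume "-b \<le> t" "t \<le> -a"
    then have z: "x + t *\<^sub>R e \<in> ball p \<epsilon>" by (rule in_ball)
    let ?D = "frechet_derivative r (at (x + t *\<^sub>R e))"
    have "(r has_derivative ?D) (at (x + t *\<^sub>R e))"
      using diff[OF z] by (simp add: frechet_derivative_works)
    then have "((\<lambda>t. r (x + t *\<^sub>R e)) has_derivative (\<lambda>s. ?D (s *\<^sub>R e))) (at t)"
      by (rule has_derivative_compose[of "\<lambda>t. x + t *\<^sub>R e", rotated])
         (auto intro!: derivative_eq_intros)
    moreover have "?D (s *\<^sub>R e) = ?D e * s" for s
      using linear_frechet_derivative[OF diff[OF z]] by (simp add: linear_scale mult.commute)
    ultimately show "\<exists>y. DERIV (\<lambda>t. r (x + t *\<^sub>R e)) t :> y \<and> y > 0"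
      using pos[OF z] by (auto simp: has_field_derivative_def)
  qed
  then show ?thesis by simp
qed

text \<open>\<open>\<rho>\<close> is read off the inverse of the injective map \<open>(x, t) \<mapsto> (x, r(x - t e))\<close>; invariance of domain
  makes its image open.\<close>

lemma implicit_function_along_direction:
  fixes r :: "'a::euclidean_space \<Rightarrow> real"
  assumes diff: "\<And>z. z \<in> ball p \<epsilon> \<Longrightarrow> r differentiable (at z)"
    and pos: "\<And>z. z \<in> ball p \<epsilon> \<Longrightarrow> frechet_derivative r (at z) e > 0"
    and "\<epsilon> > 0" "r p = 0"
  obtains V \<rho> where "open V" "p \<in> V" "V \<subseteq> ball p \<epsilon>"
    "\<And>x. x \<in> V \<Longrightarrow> x - \<rho> x *\<^sub>R e \<in> ball p \<epsilon>"
    "\<And>x. x \<in> V \<Longrightarrow> r (x - \<rho> x *\<^sub>R e) = 0"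
    "\<And>x. x \<in> V \<Longrightarrow> \<rho> differentiable (at x)"
proof -
  define S where "S = {(x, t). x - t *\<^sub>R e \<in> ball p \<epsilon>}"
  define \<Phi> where "\<Phi> = (\<lambda>(x, t). (x, r (x - t *\<^sub>R e)))"
  define g where "g = inv_into S \<Phi>"
  define \<rho> where "\<rho> = (\<lambda>x. snd (g (x, 0)))"
  \<comment> \<open>Intersecting with the ball makes the shift 0 admissible besides \<rho>(x), so
    that the two can later be compared by monotonicity. The image condition keeps
    \<open>inv_into\<close> away from its arbitrary values.\<close>
  define V where "V = {x \<in> ball p \<epsilon>. (x, 0) \<in> \<Phi> ` S}"
  have S_eq: "S = (\<lambda>z. fst z - snd z *\<^sub>R e) -` ball p \<epsilon>"
    by (auto simp: S_def)
  have "open S"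
    unfolding S_eq by (intro open_vimage continuous_intros) auto
  have deriv: "(\<Phi> has_derivative (\<lambda>(v, s). (v, frechet_derivative r (at (fst z - snd z *\<^sub>R e)) v
      - s * frechet_derivative r (at (fst z - snd z *\<^sub>R e)) e))) (at z)" if "z \<in> S" for z
  proof -
    let ?y = "fst z - snd z *\<^sub>R e"
    let ?D = "frechet_derivative r (at ?y)"
    have y: "?y \<in> ball p \<epsilon>" using that by (auto simp: S_def)
    have "(r has_derivative ?D) (at ?y)"
      using diff[OF y] by (simp add: frechet_derivative_works)
    then have "((\<lambda>z. r (fst z - snd z *\<^sub>R e)) has_derivative (\<lambda>w. ?D (fst w - snd w *\<^sub>R e))) (at z)"
      by (rule has_derivative_compose[of "\<lambda>z. fst z - snd z *\<^sub>R e", rotated])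
         (auto intro!: derivative_eq_intros)
    then have "((\<lambda>z. (fst z, r (fst z - snd z *\<^sub>R e))) has_derivative
        (\<lambda>w. (fst w, ?D (fst w - snd w *\<^sub>R e)))) (at z)"
      by (intro has_derivative_Pair has_derivative_fst has_derivative_ident)
    moreover have "?D (v - s *\<^sub>R e) = ?D v - s * ?D e" for v s
      using linear_frechet_derivative[OF diff[OF y]] by (simp add: linear_diff linear_scale)
    ultimately show ?thesis
      by (simp add: \<Phi>_def case_prod_unfold)
  qed
  have cont: "continuous_on S \<Phi>"
    by (auto intro!: continuous_at_imp_continuous_on has_derivative_continuous[OF deriv])
  \<comment> \<open>Equal images share \<open>x\<close>, and along a line in direction
    \<open>e\<close> strict monotonicity lets \<open>r\<close> determine the shift.\<close>
  have inj: "inj_on \<Phi> S"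
  proof (rule inj_onI)
    fix z w assume zw: "z \<in> S" "w \<in> S" "\<Phi> z = \<Phi> w"
    obtain x a b where [simp]: "z = (x, a)" "w = (x, b)"
      using zw(3) by (cases z, cases w) (auto simp: \<Phi>_def)
    show "z = w"
      using zw strict_mono_on_ball_line[OF diff pos, where x = x and a = a and b = b]
        strict_mono_on_ball_line[OF diff pos, where x = x and a = b and b = a]
      by (cases a b rule: linorder_cases) (auto simp: S_def \<Phi>_def)
  qed
  have g: "g (\<Phi> z) = z" if "z \<in> S" for z
    using that inj by (simp add: g_def)
  have image: "(x, \<rho> x) \<in> S \<and> \<Phi> (x, \<rho> x) = (x, 0)" if "x \<in> V" for x
  proof -
    obtain z where z: "z \<in> S" "\<Phi> z = (x, 0)" using \<open>x \<in> V\<close> by (auto simp: V_def)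
    moreover have "g (x, 0) = z" using g[OF z(1)] z(2) by simp
    ultimately show ?thesis by (cases z) (auto simp: \<rho>_def \<Phi>_def)
  qed
  have "open ((\<lambda>x. (x, 0::real)) -` (\<Phi> ` S))"
    by (intro open_vimage invariance_of_domain[OF cont \<open>open S\<close> inj] continuous_intros)
  moreover have "V = ball p \<epsilon> \<inter> (\<lambda>x. (x, 0::real)) -` (\<Phi> ` S)"
    by (auto simp: V_def)
  ultimately have "open V" by auto
  moreover have "p \<in> V"
  proof -
    have "(p, 0) \<in> S" "\<Phi> (p, 0) = (p, 0)"
      using \<open>\<epsilon> > 0\<close> \<open>r p = 0\<close> by (auto simp: S_def \<Phi>_def)
    then show ?thesis
      using \<open>\<epsilon> > 0\<close> by (metis (mono_tags, lifting) V_def centre_in_ball image_eqI mem_Collect_eq)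
  qed
  moreover have "V \<subseteq> ball p \<epsilon>" by (auto simp: V_def)
  moreover have "x - \<rho> x *\<^sub>R e \<in> ball p \<epsilon>" "r (x - \<rho> x *\<^sub>R e) = 0" if "x \<in> V" for x
    using image[OF that] by (auto simp: S_def \<Phi>_def)
  moreover have "\<rho> differentiable (at x)" if "x \<in> V" for x
  proof -
    let ?D = "frechet_derivative r (at (x - \<rho> x *\<^sub>R e))"
    have xS: "(x, \<rho> x) \<in> S" and \<Phi>x: "\<Phi> (x, \<rho> x) = (x, 0)" using image[OF that] by auto
    have "?D e > 0" using xS pos by (auto simp: S_def)
    \<comment> \<open>\<open>G\<close> inverts the derivative of \<Phi>: solving Dv - s De = w for s
      gives s = (Dv - w) / De, where De > 0.\<close>
    define G where "G = (\<lambda>(v, s). (v, (?D v - s) / ?D e))"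
    have "(g has_derivative G) (at (\<Phi> (x, \<rho> x)))"
      by (rule has_derivative_inverse_strong[OF \<open>open S\<close> xS cont g deriv[OF xS]])
         (use \<open>?D e > 0\<close> in \<open>auto simp: G_def fun_eq_iff\<close>)
    then have "(g has_derivative G) (at (x, 0))" by (simp add: \<Phi>x)
    then have "((\<lambda>x. g (x, 0)) has_derivative (\<lambda>v. G (v, 0))) (at x)"
      by (rule has_derivative_compose[of "\<lambda>x. (x, 0)", rotated])
         (auto intro!: derivative_eq_intros)
    then have "(\<rho> has_derivative (\<lambda>v. snd (G (v, 0)))) (at x)"
      unfolding \<rho>_def by (rule has_derivative_snd)
    then show ?thesis by (auto simp: differentiable_def)
  qed
  ultimately show ?thesis using that by blast
qed

section \<open>Smoothness and Hessian of the implicitly defined function\<close>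

locale implicit_defining_function =
  fixes r \<rho> :: "real ^ 'n \<Rightarrow> real" and V :: "(real ^ 'n) set" and e :: "real ^ 'n"
  assumes smooth: "smooth_on r UNIV" and open_V: "open V"
    and diff: "\<And>x. x \<in> V \<Longrightarrow> \<rho> differentiable (at x)"
    and zero: "\<And>x. x \<in> V \<Longrightarrow> r (x - \<rho> x *\<^sub>R e) = 0"
    and pos: "\<And>x. x \<in> V \<Longrightarrow> frechet_derivative r (at (x - \<rho> x *\<^sub>R e)) e > 0"
begin

lemma C_k_r: "C_k_on k r UNIV"
  using smooth by (simp add: smooth_on_def)

lemma C_k_deriv_r: "C_k_on k (\<lambda>z. frechet_derivative r (at z) v) UNIV"
  using C_k_r[of "Suc k"] by simp

lemma linear_deriv_r: "linear (frechet_derivative r (at z))"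
  using C_k_r[of 1] by (auto intro: linear_frechet_derivative)

text \<open>The chain rule applied to r(x - \<rho>(x) e), which vanishes throughout the open set
  \<open>V\<close>. Rearranged, it places v - (D\<rho>(x)v) e in the kernel of the derivative of
  \<open>r\<close> at the shifted point.\<close>

lemma deriv_identity:
  assumes "x \<in> V"
  shows "frechet_derivative r (at (x - \<rho> x *\<^sub>R e)) v =
    frechet_derivative \<rho> (at x) v * frechet_derivative r (at (x - \<rho> x *\<^sub>R e)) e"
proof -
  have D: "((\<lambda>x. r (x - \<rho> x *\<^sub>R e)) has_derivative
      (\<lambda>v. frechet_derivative r (at (x - \<rho> x *\<^sub>R e)) v -
        frechet_derivative \<rho> (at x) v * frechet_derivative r (at (x - \<rho> x *\<^sub>R e)) e)) (at x)"
    by (intro has_derivative_shift_compose C_k_on_Suc_has_derivative[OF C_k_r])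
       (use diff assms in \<open>auto simp: frechet_derivative_works\<close>)
  from frechet_derivative_eqI[OF D, of v]
  have "frechet_derivative (\<lambda>x. r (x - \<rho> x *\<^sub>R e)) (at x) v =
    frechet_derivative r (at (x - \<rho> x *\<^sub>R e)) v -
        frechet_derivative \<rho> (at x) v * frechet_derivative r (at (x - \<rho> x *\<^sub>R e)) e" .
  moreover have "frechet_derivative (\<lambda>x. r (x - \<rho> x *\<^sub>R e)) (at x) = frechet_derivative (\<lambda>x. 0) (at x)"
    by (rule frechet_derivative_transform_within_open[OF differentiableI[OF D] open_V assms zero])
  ultimately show ?thesis by simp
qed

text \<open>Bootstrapping: \<open>deriv_identity\<close> expresses D\<rho>(x)v as a quotient of
  derivatives of \<open>r\<close> at x - \<rho>(x) e. If \<rho> is of class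
  \<open>C\<^sup>k\<close>, so is this quotient, and \<rho> gains one order.\<close>

lemma smooth_implicit: "smooth_on \<rho> V"
proof -
  have "C_k_on k \<rho> V" for k
  proof (induction k)
    case 0
    show ?case
      using diff by (auto intro!: continuous_at_imp_continuous_on differentiable_imp_continuous_within)
  next
    case (Suc k)
    let ?D = "\<lambda>v x. frechet_derivative r (at (x - \<rho> x *\<^sub>R e)) v"
    have D: "C_k_on k (?D v) V" for v
      by (rule C_k_on_shift_compose[OF open_V C_k_deriv_r Suc])
    have "C_k_on k (\<lambda>x. frechet_derivative \<rho> (at x) v) V" for v
    proof (rule C_k_on_cong[OF open_V])
      show "C_k_on k (\<lambda>x. ?D v x * inverse (?D e x)) V"
        by (intro C_k_on_mult C_k_on_inverse D open_V) (use pos in force)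
      show "?D v x * inverse (?D e x) = frechet_derivative \<rho> (at x) v" if "x \<in> V" for x
        using deriv_identity[OF that, of v] pos[OF that] by (simp add: field_simps)
    qed
    then show ?case using diff by simp
  qed
  then show ?thesis using open_V by (simp add: smooth_on_def)
qed

text \<open>Differentiate \<open>deriv_identity\<close> with v = \<xi> once more in direction \<xi>.
  The product rule on the right yields the second derivative of \<rho> times Dr(y)e plus a term in
  the second derivative of \<open>r\<close>; moving that term to the left completes the quadratic
  form at \<tau>.\<close>

lemma hessian_identity:
  fixes \<xi> :: "real ^ 'n"
  assumes "x \<in> V"
  defines "y \<equiv> x - \<rho> x *\<^sub>R e" and "\<tau> \<equiv> \<xi> - frechet_derivative \<rho> (at x) \<xi> *\<^sub>R e"
  shows "hessian_form \<rho> x \<xi> * frechet_derivative r (at y) e = hessian_form r y \<tau>"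
proof -
  let ?D = "\<lambda>v z. frechet_derivative r (at z) v"
  let ?D2 = "\<lambda>v. frechet_derivative (?D v) (at y)"
  define a where "a = (\<lambda>x. frechet_derivative \<rho> (at x) \<xi>)"
  let ?A = "frechet_derivative a (at x)"
  have \<rho>: "C_k_on k \<rho> V" for k
    using smooth_implicit by (simp add: smooth_on_def)
  have a: "(a has_derivative ?A) (at x)"
  proof (rule C_k_on_Suc_has_derivative)
    show "C_k_on (Suc 0) a V"
      using \<rho>[of "Suc (Suc 0)"] unfolding a_def C_k_on.simps(2)[of "Suc 0"] by blast
  qed fact
  have D2: "(?D v has_derivative ?D2 v) (at y)" for v
    by (rule C_k_on_Suc_has_derivative[OF C_k_deriv_r[of "Suc 0"] UNIV_I])
  have lin2: "linear (?D2 v)" for v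
    using D2 has_derivative_linear by blast
  have shift: "((\<lambda>x. ?D v (x - \<rho> x *\<^sub>R e)) has_derivative
      (\<lambda>w. ?D2 v w - frechet_derivative \<rho> (at x) w * ?D2 v e)) (at x)" for v
    using D2 diff[OF \<open>x \<in> V\<close>] unfolding y_def
    by (intro has_derivative_shift_compose) (auto simp: frechet_derivative_works)
  \<comment> \<open>When \<open>x\<close> moves with velocity \<xi>, the point x - \<rho>(x) e moves
    with velocity \<tau>.\<close>
  have shift_\<xi>: "frechet_derivative (\<lambda>x. ?D v (x - \<rho> x *\<^sub>R e)) (at x) \<xi> = ?D2 v \<tau>" for v
    using lin2[of v] by (simp add: frechet_derivative_eqI[OF shift] \<tau>_def linear_diff linear_scale)
  have "?D2 \<xi> \<tau> = frechet_derivative (\<lambda>x. a x * ?D e (x - \<rho> x *\<^sub>R e)) (at x) \<xi>"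
  proof -
    have "frechet_derivative (\<lambda>x. ?D \<xi> (x - \<rho> x *\<^sub>R e)) (at x) =
        frechet_derivative (\<lambda>x. a x * ?D e (x - \<rho> x *\<^sub>R e)) (at x)"
      unfolding a_def
      by (rule frechet_derivative_transform_within_open[OF differentiableI[OF shift] open_V \<open>x \<in> V\<close>
            deriv_identity])
    with shift_\<xi>[of \<xi>] show ?thesis by metis
  qed
  also have "\<dots> = a x * ?D2 e \<tau> + ?A \<xi> * ?D e y"
    using frechet_derivative_eqI[OF has_derivative_mult[OF a shift[of e]], of \<xi>]
      frechet_derivative_eqI[OF shift[of e], of \<xi>] shift_\<xi>[of e]
    by (simp add: y_def)
  finally have "?A \<xi> * ?D e y = ?D2 \<xi> \<tau> - a x * ?D2 e \<tau>" by simp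
  also have "\<dots> = ?D2 \<tau> \<tau>"
  proof -
    \<comment> \<open>Here \<tau> and the coefficient \<open>a x\<close> are frozen at the given
      \<open>x\<close> while \<open>z\<close> varies, so no derivative of \<open>a\<close>
      arises.\<close>
    have "?D \<tau> = (\<lambda>z. ?D \<xi> z - a x * ?D e z)"
      using linear_deriv_r by (simp add: \<tau>_def a_def linear_diff linear_scale fun_eq_iff)
    moreover have D: "((\<lambda>z. ?D \<xi> z - a x * ?D e z) has_derivative (\<lambda>w. ?D2 \<xi> w - a x * ?D2 e w)) (at y)"
      by (intro has_derivative_diff has_derivative_mult_right D2)
    ultimately show ?thesis
      using frechet_derivative_eqI[OF D, of \<tau>] by metis
  qed
  finally show ?thesis
    using hessian_form_eq[OF open_V \<open>x \<in> V\<close> \<rho>, of \<xi>]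
      hessian_form_eq[OF open_UNIV UNIV_I C_k_r, of y \<tau>]
    by (simp add: a_def)
qed

end

section \<open>Choice of the direction and convexity of the implicit function\<close>

theorem proposition4p1:
  fixes \<Omega> :: "(real ^ 'n) set" and p :: "real ^ 'n"
  assumes "open \<Omega>" and "connected \<Omega>" and "\<Omega> \<noteq> {}"
    and "smoothly_bounded \<Omega>"
    and "convex_boundary \<Omega>"
    and "p \<in> frontier \<Omega>"
  shows "\<exists>V \<rho>. open V \<and> p \<in> V \<and> smooth_on \<rho> V \<and> local_defining_function \<rho> \<Omega> V \<and>
           (\<forall>x\<in>V. \<forall>\<xi>. hessian_form \<rho> x \<xi> \<ge> 0)"
proof -
  obtain r where r: "regular_defining_function r \<Omega>"
    and hess: "\<And>q \<tau>. q \<in> frontier \<Omega> \<Longrightarrow> \<tau> \<in> tangent_space r q \<Longrightarrow> hessian_form r q \<tau> \<ge> 0"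
    using assms(5) unfolding convex_boundary_def by blast
  have \<Omega>: "\<Omega> = {x. r x < 0}" and frontier: "frontier \<Omega> = {x. r x = 0}"
    and smooth: "smooth_on r UNIV"
    using r by (auto simp: regular_defining_function_def defining_function_def)
  have "r p = 0" using assms(6) frontier by auto
  have "C_k_on (Suc 0) r UNIV"
    using smooth unfolding smooth_on_def by blast
  then have diff: "r differentiable (at z)"
    and cont: "continuous_on UNIV (\<lambda>z. frechet_derivative r (at z) v)" for z v
    by auto
  define e where "e = grad r p"
  have "e \<noteq> 0"
    using r \<open>r p = 0\<close> unfolding regular_defining_function_def e_def by blast
  \<comment> \<open>The derivative of \<open>r\<close> at \<open>p\<close> in the direction of its
    own gradient is the squared norm of \<open>e\<close>; continuity keeps it positive on a
    ball.\<close>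
  then have "frechet_derivative r (at p) e > 0"
    using inner_grad[OF diff, of p e] inner_gt_zero_iff[of e] by (simp add: e_def)
  moreover have "open {z. 0 < frechet_derivative r (at z) e}"
    by (rule open_Collect_less[OF continuous_on_const cont])
  ultimately obtain \<epsilon> where "\<epsilon> > 0" and \<epsilon>: "ball p \<epsilon> \<subseteq> {z. 0 < frechet_derivative r (at z) e}"
    unfolding open_contains_ball by blast
  then have pos: "frechet_derivative r (at z) e > 0" if "z \<in> ball p \<epsilon>" for z
    using that by blast
  obtain V \<rho> where V: "open V" "p \<in> V" "V \<subseteq> ball p \<epsilon>"
    and \<rho>_ball: "\<And>x. x \<in> V \<Longrightarrow> x - \<rho> x *\<^sub>R e \<in> ball p \<epsilon>"
    and \<rho>_zero: "\<And>x. x \<in> V \<Longrightarrow> r (x - \<rho> x *\<^sub>R e) = 0"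
    and \<rho>_diff: "\<And>x. x \<in> V \<Longrightarrow> \<rho> differentiable (at x)"
    by (rule implicit_function_along_direction[OF diff pos \<open>\<epsilon> > 0\<close> \<open>r p = 0\<close>]) (assumption, rule that)
  interpret implicit: implicit_defining_function r \<rho> V e
    by unfold_locales (fact smooth, fact V(1), fact \<rho>_diff, fact \<rho>_zero, rule pos[OF \<rho>_ball])
  \<comment> \<open>The shifts 0 and \<rho>(x) on one line give the values r(x) and 0. As
    \<open>r\<close> decreases with the shift, r(x) < 0 holds exactly when \<rho>(x) < 0.\<close>
  have sign: "r x < 0 \<longleftrightarrow> \<rho> x < 0" if "x \<in> V" for x
  proof -
    have x: "x - 0 *\<^sub>R e \<in> ball p \<epsilon>" using that V by auto
    show ?thesis
      using strict_mono_on_ball_line[OF diff pos x \<rho>_ball[OF that]]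
        strict_mono_on_ball_line[OF diff pos \<rho>_ball[OF that] x] \<rho>_zero[OF that]
      by (cases "\<rho> x" "0::real" rule: linorder_cases) auto
  qed
  have "hessian_form \<rho> x \<xi> \<ge> 0" if "x \<in> V" for x \<xi>
  proof -
    let ?y = "x - \<rho> x *\<^sub>R e" and ?\<tau> = "\<xi> - frechet_derivative \<rho> (at x) \<xi> *\<^sub>R e"
    \<comment> \<open>The boundary hypothesis covers only boundary points and tangent vectors;
      \<open>?y\<close> and \<open>?\<tau>\<close> are such a pair for every \<open>x\<close> in
      \<open>V\<close> and every \<xi>, so convexity holds on all of \<open>V\<close> and in all
      directions.\<close>
    have "grad r ?y \<bullet> ?\<tau> = 0"
      using implicit.deriv_identity[OF that, of \<xi>] implicit.linear_deriv_r[of ?y]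
      by (simp add: inner_grad[OF diff] linear_diff linear_scale)
    then have "hessian_form r ?y ?\<tau> \<ge> 0"
      using \<rho>_zero[OF that] by (intro hess) (auto simp: frontier tangent_space_def)
    then show ?thesis
      unfolding implicit.hessian_identity[OF that, symmetric]
      using pos[OF \<rho>_ball[OF that]] by (simp add: zero_le_mult_iff)
  qed
  moreover have "local_defining_function \<rho> \<Omega> V"
    using sign V by (auto simp: local_defining_function_def \<Omega>)
  ultimately show ?thesis
    using V implicit.smooth_implicit by blast
qed

end
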